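(* Let $p$ be an odd prime and let $k$ be a field of characteristic $p$. Let $f\in k[[\zeta]]$ be of the form $$f(\zeta)=\zeta\left(1+\sum_{j=2}^{+\infty}a_j\zeta^j\right).$$ Put $$\alpha_1:=a_2^{p-2}\left(\tfrac32a_2^3+a_3^2-a_2a_4\right),\qquad \beta_1:=\frac{a_3}{a_2}\,\alpha_1,\qquad \gamma_1:=-\left(\frac{3a_2}{2}-\frac{a_4}{a_2}\right)\alpha_1.$$ Then $$f^p(\zeta)\equiv\zeta+\alpha_1\zeta^{2p+3}+\beta_1\zeta^{2p+4}+\gamma_1\zeta^{2p+5}\mod\langle\zeta^{2p+6}\rangle.$$
   Context: $f^{p}$ denotes the $p$-fold composition of $f$ with itself, and $\langle \zeta^{N}\rangle$ is the ideal of $k[[\zeta]]$ generated by $\zeta^N$. Since $p-2\ge1$, the expressions $\beta_1$ and $\gamma_1$ are polynomials in $a_2,a_3,a_4$ (cancel the factor $a_2$ in the denominator against $\alpha_1$), and this is how they are understood when $a_2=0$. *)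

theory Defs
  imports "HOL-Computational_Algebra.Computational_Algebra"
begin

definition fps_iter :: "nat \<Rightarrow> 'k::field fps \<Rightarrow> 'k fps" where
  "fps_iter n f = ((\<lambda>g. f oo g) ^^ n) fps_X"

definition alpha1 :: "nat \<Rightarrow> (nat \<Rightarrow> 'k::field) \<Rightarrow> 'k" where
  "alpha1 p a = a 2 ^ (p - 2) * (3 / 2 * a 2 ^ 3 + a 3 ^ 2 - a 2 * a 4)"

(* beta1 and gamma1 are the polynomials obtained from a 3 / a 2 * alpha1 p a and
   - (3 * a 2 / 2 - a 4 / a 2) * alpha1 p a by cancelling a 2 against one factor of
   a 2 ^ (p - 2). The quotients themselves would be wrong for a 2 = 0, where HOL
   evaluates division by a 2 to 0. *)
definition beta1 :: "nat \<Rightarrow> (nat \<Rightarrow> 'k::field) \<Rightarrow> 'k" where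
  "beta1 p a = a 3 * (a 2 ^ (p - 3) * (3 / 2 * a 2 ^ 3 + a 3 ^ 2 - a 2 * a 4))"

definition gamma1 :: "nat \<Rightarrow> (nat \<Rightarrow> 'k::field) \<Rightarrow> 'k" where
  "gamma1 p a = - (3 * a 2 ^ 2 / 2 - a 4)
                  * (a 2 ^ (p - 3) * (3 / 2 * a 2 ^ 3 + a 3 ^ 2 - a 2 * a 4))"

lemma alpha1_eq:
  assumes "p \<ge> 3"
  shows "alpha1 p a = a 2 * (a 2 ^ (p - 3) * (3 / 2 * a 2 ^ 3 + a 3 ^ 2 - a 2 * a 4))"
proof -
  have "p - 2 = Suc (p - 3)" using assms by simp
  then show ?thesis by (simp only: alpha1_def power_Suc mult.assoc)
qed

lemma beta1_eq:
  assumes "p \<ge> 3" and "a 2 \<noteq> 0"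
  shows "beta1 p a = a 3 / a 2 * alpha1 p a"
  using assms(2) by (simp add: beta1_def alpha1_eq [OF assms(1)])

lemma gamma1_eq:
  assumes "p \<ge> 3" and "a 2 \<noteq> 0"
  shows "gamma1 p a = - (3 * a 2 / 2 - a 4 / a 2) * alpha1 p a"
proof -
  have "- (3 * a 2 ^ 2 / 2 - a 4) = - (3 * a 2 / 2 - a 4 / a 2) * a 2"
    using assms(2) by (simp add: left_diff_distrib power2_eq_square)
  then show ?thesis
    by (simp only: gamma1_def alpha1_eq [OF assms(1)] mult.assoc)
qed

end

theory Submission
  imports Defs "HOL-Number_Theory.Residues"
begin

text \<open>
  Let \<open>f = X * u\<close> with \<open>u = 1 + a\<^sub>2 X\<^sup>2 + a\<^sub>3 X\<^sup>3 + \<dots>\<close>, and let \<open>T g = g \<circ> f - g\<close>.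
  Precomposition with \<open>f\<close> is the linear map \<open>id + T\<close>, so in characteristic \<open>p\<close>
  its \<open>p\<close>-th power is \<open>id + T\<^sup>p\<close>, and \<open>f\<^sup>p = X + w\<close> with \<open>w = T\<^sup>p X\<close>
  (\<open>fps_iter_char_eq_comp_diff\<close>). The map \<open>T\<close> raises the order of a power series by at least
  two, so \<open>w\<close> has order at least \<open>2p + 1\<close>.

  Suppose \<open>a\<^sub>2 \<noteq> 0\<close>. The coefficients of \<open>T\<^sup>m X\<close> in the three degrees \<open>2m + 1\<close>, \<open>2m + 2\<close>,
  \<open>2m + 3\<close> obey linear recurrences in \<open>m\<close> that are solved by the products
  \<open>1 \<cdot> 3 \<cdots> (2m - 1)\<close> and \<open>2 \<cdot> 4 \<cdots> (2m)\<close> and by one further sequence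
  (\<open>comp_diff_iterate_X_nth\<close>). At \<open>m = p\<close> both products vanish, which kills the degrees
  \<open>2p + 1\<close> and \<open>2p + 2\<close>. The further sequence retains only what entered it just before its
  multiplier passed through \<open>p = 0\<close> (\<open>odd_rec_past_zero\<close>), multiplied by a product equal to
  \<open>(p - 1)! = -1\<close>. This gives the coefficient \<open>\<alpha>\<^sub>1\<close>.

  The other two coefficients would involve \<open>a\<^sub>5\<close> and \<open>a\<^sub>6\<close> if they were computed in the same way.
  Instead they are read off from the fact that \<open>f\<^sup>p\<close> commutes with \<open>f\<close>. Up to terms of second
  order in \<open>w\<close>, commuting says \<open>T w = (f' - 1) w\<close>; comparing coefficients in the two degrees
  after the leading one expresses \<open>\<beta>\<^sub>1\<close> and \<open>\<gamma>\<^sub>1\<close> through \<open>\<alpha>\<^sub>1\<close>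
  (\<open>commuting_perturbation_nth\<close>).

  Suppose \<open>a\<^sub>2 = 0\<close>. Then \<open>T\<close> raises orders by at least three and \<open>w\<close> has order at least
  \<open>3p + 1\<close>. For \<open>p \<ge> 5\<close> this exceeds \<open>2p + 5\<close>, and the three predicted coefficients
  vanish too. For \<open>p = 3\<close> the coefficients in degrees \<open>10\<close> and \<open>11\<close> remain, and three
  applications of \<open>T\<close> yield them.
\<close>

unbundle fps_syntax

section \<open>The difference operator of precomposition\<close>

lemma fps_power_nth_low:
  fixes u :: "'k::field fps"
  assumes "u $ 0 = 1" "u $ 1 = 0"
  shows "(u ^ n) $ 0 = 1" "(u ^ n) $ 1 = 0"
    and "(u ^ n) $ 2 = of_nat n * u $ 2" "(u ^ n) $ 3 = of_nat n * u $ 3"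
    and "(u ^ n) $ 4 = of_nat n * u $ 4 + of_nat (n choose 2) * (u $ 2) ^ 2"
proof (induction n)
  case 0
  { case 1 show ?case by simp next case 2 show ?case by simp next case 3 show ?case by simp
    next case 4 show ?case by simp next case 5 show ?case by (simp add: binomial_eq_0) }
next
  case (Suc n)
  have idx: "{0..2::nat} = {0, 1, 2}" "{0..3::nat} = {0, 1, 2, 3}"
    "{0..4::nat} = {0, 1, 2, 3, 4}"
    by auto
  have ch: "Suc n choose 2 = n + (n choose 2)"
    by (simp add: numeral_2_eq_2)
  note IH = Suc
  { case 1 show ?case using IH assms by simp
    next case 2 show ?case using IH assms by simp
    next case 3 show ?case
      using IH assms by (simp add: fps_mult_nth idx algebra_simps)
    next case 4 show ?case
      using IH assms by (simp add: fps_mult_nth idx algebra_simps)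
    next case 5 show ?case
      unfolding ch using IH assms
      by (simp add: fps_mult_nth idx algebra_simps power2_eq_square) }
qed

definition comp_diff :: "'k::field fps \<Rightarrow> 'k fps \<Rightarrow> 'k fps" where
  "comp_diff f g = (g oo f) - g"

text \<open>
  The operator acts on monomials by \<open>X\<^sup>i \<mapsto> X\<^sup>i (u\<^sup>i - 1)\<close>. Since \<open>u - 1\<close> has order at
  least two, each coefficient of the image depends only on coefficients of \<open>g\<close> at least two
  degrees lower. Three degrees suffice for everything below, since the terms of \<open>u\<close> beyond
  degree four do not enter them.
\<close>
lemma comp_diff_nth:
  fixes u g :: "'k::field fps"
  assumes u: "u $ 0 = 1" "u $ 1 = 0" and g: "\<And>j. j < M \<Longrightarrow> g $ j = 0"
  defines "f \<equiv> fps_X * u"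
  shows "\<And>j. j < M + 2 \<Longrightarrow> comp_diff f g $ j = 0"
    and "comp_diff f g $ (M + 2) = of_nat M * u $ 2 * g $ M"
    and "comp_diff f g $ (M + 3) = of_nat M * u $ 3 * g $ M + of_nat (M + 1) * u $ 2 * g $ (M + 1)"
    and "comp_diff f g $ (M + 4) = (of_nat M * u $ 4 + of_nat (M choose 2) * (u $ 2) ^ 2) * g $ M
           + of_nat (M + 1) * u $ 3 * g $ (M + 1) + of_nat (M + 2) * u $ 2 * g $ (M + 2)"
proof -
  have fi: "(f ^ i) $ n = (if n < i then 0 else (u ^ i) $ (n - i))" for i n
    by (simp add: f_def power_mult_distrib fps_X_power_mult_nth)
  have sum: "(g oo f) $ n = (\<Sum>i\<in>{M..n}. g $ i * (u ^ i) $ (n - i))" for n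
    unfolding fps_compose_nth fi
    by (rule sum.mono_neutral_cong_right) (auto simp: g)
  note low = fps_power_nth_low[OF u]
  have low': "(u ^ n) $ Suc 0 = 0" for n
    using low(2)[of n] by simp
  have idx: "{M..M + 1} = {M, M + 1}" "{M..M + 2} = {M, M + 1, M + 2}"
    "{M..M + 3} = {M, M + 1, M + 2, M + 3}"
    "{M..M + 4} = {M, M + 1, M + 2, M + 3, M + 4}"
    by auto
  show "comp_diff f g $ j = 0" if j: "j < M + 2" for j
  proof -
    consider "j < M" | "j = M" | "j = M + 1" using j by linarith
    then show ?thesis
    proof cases
      case 3
      show ?thesis
        unfolding 3 comp_diff_def fps_sub_nth sum idx using u by (simp add: low low' del: power_Suc)
    qed (simp_all add: comp_diff_def sum g low low' u)
  qed
  show "comp_diff f g $ (M + 2) = of_nat M * u $ 2 * g $ M"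
    unfolding comp_diff_def fps_sub_nth sum idx using u by (simp add: low low' del: power_Suc)
  show "comp_diff f g $ (M + 3) = of_nat M * u $ 3 * g $ M + of_nat (M + 1) * u $ 2 * g $ (M + 1)"
    unfolding comp_diff_def fps_sub_nth sum idx using u by (simp add: low low' del: power_Suc)
  show "comp_diff f g $ (M + 4) = (of_nat M * u $ 4 + of_nat (M choose 2) * (u $ 2) ^ 2) * g $ M
           + of_nat (M + 1) * u $ 3 * g $ (M + 1) + of_nat (M + 2) * u $ 2 * g $ (M + 2)"
    unfolding comp_diff_def fps_sub_nth sum idx using u by (simp add: low low' del: power_Suc)
qed

text \<open>
  This is the binomial expansion of \<open>(id + T)\<^sup>n\<close>, where \<open>T\<close> is the difference operator.
\<close>
lemma comp_diff_iterate_binomial: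
  fixes f g :: "'k::field fps"
  shows "((\<lambda>h. h oo f) ^^ n) g = (\<Sum>k\<le>n. of_nat (n choose k) * (comp_diff f ^^ k) g)"
proof (induction n)
  case 0
  show ?case by simp
next
  case (Suc n)
  let ?T = "\<lambda>k. (comp_diff f ^^ k) g"
  have S: "?T k oo f = ?T k + ?T (Suc k)" for k
    by (simp add: comp_diff_def)
  have c: "(of_nat m * h) oo f = of_nat m * (h oo f)" for m and h :: "'k fps"
    by (induction m) (simp_all add: fps_compose_add_distrib ring_distribs)
  have "((\<lambda>h. h oo f) ^^ Suc n) g = (\<Sum>k\<le>n. of_nat (n choose k) * ?T k) oo f"
    by (simp add: Suc)
  also have "\<dots> = (\<Sum>k\<le>n. of_nat (n choose k) * ?T k) + (\<Sum>k\<le>n. of_nat (n choose k) * ?T (Suc k))"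
    by (simp only: fps_compose_sum_distrib c S distrib_left sum.distrib)
  also have "(\<Sum>k\<le>n. of_nat (n choose k) * ?T k) = (\<Sum>k\<le>Suc n. of_nat (n choose k) * ?T k)"
    by (simp add: binomial_eq_0)
  also have "\<dots> = ?T 0 + (\<Sum>k\<le>n. of_nat (n choose Suc k) * ?T (Suc k))"
    by (subst sum.atMost_Suc_shift) simp
  also have "\<dots> + (\<Sum>k\<le>n. of_nat (n choose k) * ?T (Suc k))
      = ?T 0 + (\<Sum>k\<le>n. of_nat (Suc n choose Suc k) * ?T (Suc k))"
    by (simp add: sum.distrib ring_distribs add_ac)
  also have "\<dots> = (\<Sum>k\<le>Suc n. of_nat (Suc n choose k) * ?T k)"
    by (subst sum.atMost_Suc_shift[of _ n]) simp
  finally show ?case .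
qed

text \<open>
  Iterates are defined by composing with \<open>f\<close> on the left, whereas the map linear in its argument is
  composition on the right. The two agree because \<open>f\<close> commutes with its iterates.
\<close>
lemma fps_iter_eq_precompose:
  fixes f :: "'k::field fps"
  assumes "f $ 0 = 0"
  shows "fps_iter n f = ((\<lambda>h. h oo f) ^^ n) fps_X"
    and "fps_iter n f oo f = f oo fps_iter n f"
proof -
  have 0: "fps_iter n f $ 0 = 0" for n
    by (cases n) (simp_all add: fps_iter_def assms)
  have X: "fps_X oo f = f"
    by (rule fps_ext) (use assms in \<open>simp add: fps_X_fps_compose\<close>)
  have comm: "fps_iter n f oo f = f oo fps_iter n f" for n
  proof (induction n)
    case 0
    show ?case by (simp add: fps_iter_def X)
  next
    case (Suc n)
    have S: "fps_iter (Suc n) f = f oo fps_iter n f" by (simp add: fps_iter_def)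
    have "fps_iter (Suc n) f oo f = f oo (fps_iter n f oo f)"
      unfolding S using 0 assms by (simp add: fps_compose_assoc)
    then show ?case by (simp only: Suc S)
  qed
  show "fps_iter n f oo f = f oo fps_iter n f"
    by (fact comm)
  show "fps_iter n f = ((\<lambda>h. h oo f) ^^ n) fps_X"
  proof (induction n)
    case 0
    show ?case by (simp add: fps_iter_def)
  next
    case (Suc n)
    have "fps_iter (Suc n) f = fps_iter n f oo f"
      unfolding comm by (simp add: fps_iter_def)
    then show ?case by (simp add: Suc)
  qed
qed

text \<open>
  In the binomial expansion only the two extreme terms survive, since \<open>p\<close> divides the other
  binomial coefficients.
\<close>
lemma fps_iter_char_eq_comp_diff:
  fixes f :: "'k::field fps"
  assumes "prime p" "CHAR('k) = p" "f $ 0 = 0"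
  shows "fps_iter p f = fps_X + (comp_diff f ^^ p) fps_X"
proof -
  have mid: "(of_nat (p choose k) :: 'k fps) = 0" if "0 < k" "k < p" for k
  proof -
    have "p dvd (p choose k)"
      using that assms(1) by (intro dvd_choose_prime) auto
    then have "(of_nat (p choose k) :: 'k) = 0"
      using assms(2) by (simp add: of_nat_eq_0_iff_char_dvd)
    then show ?thesis by (simp flip: fps_of_nat)
  qed
  have p: "p > 0" using assms(1) by (rule prime_gt_0_nat)
  have "fps_iter p f = (\<Sum>k\<le>p. of_nat (p choose k) * (comp_diff f ^^ k) fps_X)"
    unfolding fps_iter_eq_precompose(1)[OF assms(3)] by (rule comp_diff_iterate_binomial)
  also have "\<dots> = (\<Sum>k\<in>{0, p}. of_nat (p choose k) * (comp_diff f ^^ k) fps_X)"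
    by (rule sum.mono_neutral_right) (auto simp: mid)
  finally show ?thesis using p by simp
qed

section \<open>Series commuting with a perturbation of the identity\<close>

text \<open>
  First-order Taylor expansion: the error of \<open>f (X + w) \<approx> f + f' w\<close> is a multiple of
  \<open>w\<^sup>2\<close>, which has order at least \<open>2M\<close>.
\<close>
lemma fps_compose_taylor1_nth:
  fixes f w :: "'k::field fps"
  assumes w: "\<And>j. j < M \<Longrightarrow> w $ j = 0" and n: "n < 2 * M"
  shows "(f oo (fps_X + w)) $ n = f $ n + (fps_deriv f * w) $ n"
proof -
  define v where "v = fps_shift M w"
  have wv: "w = fps_X ^ M * v"
    by (rule fps_ext) (auto simp: v_def fps_X_power_mult_nth w)
  \<comment> \<open>Truncated subtraction in \<open>i - 1\<close> is harmless: for \<open>i = 0\<close> its term has the factor \<open>0\<close>.\<close>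
  have "\<exists>r. (fps_X + w) ^ i = fps_X ^ i + of_nat i * fps_X ^ (i - 1) * w + w ^ 2 * r" for i
  proof (induction i)
    case 0
    show ?case by (rule exI[of _ 0]) simp
  next
    case (Suc i)
    then obtain r where r: "(fps_X + w) ^ i = fps_X ^ i + of_nat i * fps_X ^ (i - 1) * w + w ^ 2 * r"
      by blast
    have "(fps_X + w) ^ Suc i = fps_X ^ Suc i + of_nat (Suc i) * fps_X ^ i * w
        + w ^ 2 * (of_nat i * fps_X ^ (i - 1) + (fps_X + w) * r)"
      unfolding power_Suc r by (cases i) (simp_all add: power2_eq_square algebra_simps)
    then show ?case by auto
  qed
  then obtain r where r: "(fps_X + w) ^ i = fps_X ^ i + of_nat i * fps_X ^ (i - 1) * w + w ^ 2 * r i" for i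
    by metis
  have sq: "(w ^ 2 * r i) $ n = 0" for i
  proof -
    have "w ^ 2 * r i = fps_X ^ (2 * M) * (v ^ 2 * r i)"
      by (simp add: wv power_mult_distrib mult.assoc mult.commute[of 2] flip: power_mult)
    then show ?thesis using n by (simp only: fps_X_power_mult_nth if_True)
  qed
  have lin: "(of_nat i * fps_X ^ (i - 1) * w) $ n
      = of_nat i * (if n < i - 1 then 0 else w $ (n - (i - 1)))" for i
  proof -
    have "of_nat i * fps_X ^ (i - 1) * w = fps_const (of_nat i) * (fps_X ^ (i - 1) * w)"
      by (simp add: fps_of_nat mult.assoc)
    then show ?thesis by (simp only: fps_mult_left_const_nth fps_X_power_mult_nth)
  qed
  have "(f oo (fps_X + w)) $ n
      = (\<Sum>i=0..n. f $ i * (if n = i then 1 else 0))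
        + (\<Sum>i=0..n. f $ i * (of_nat i * (if n < i - 1 then 0 else w $ (n - (i - 1)))))"
    unfolding fps_compose_nth r fps_add_nth sq lin
    by (simp add: distrib_left sum.distrib del: mult_eq_0_iff)
  also have "(\<Sum>i=0..n. f $ i * (if n = i then 1 else 0)) = f $ n"
    by (simp add: mult_delta_right)
  \<comment> \<open>The extra summand contains \<open>w $ 0\<close>, which is zero as \<open>0 < M\<close>; it makes the shift of the
    index match the convolution with the derivative.\<close>
  also have "(\<Sum>i=0..n. f $ i * (of_nat i * (if n < i - 1 then 0 else w $ (n - (i - 1)))))
      = (\<Sum>i=0..Suc n. f $ i * (of_nat i * (if n < i - 1 then 0 else w $ (n - (i - 1)))))"
    using n w[of 0] by simp
  also have "\<dots> = (\<Sum>i=0..n. f $ Suc i * (of_nat (Suc i) * w $ (n - i)))"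
    by (subst sum.atLeast0_atMost_Suc_shift) (auto intro!: sum.cong)
  also have "\<dots> = (fps_deriv f * w) $ n"
    unfolding fps_mult_nth by (rule sum.cong) (simp_all add: algebra_simps)
  finally show ?thesis .
qed


text \<open>
  Writing out \<open>f \<circ> (X + w) = (X + w) \<circ> f\<close> with the Taylor formula gives
  \<open>w \<circ> f - w = (f' - 1) w\<close> below degree \<open>2M\<close>, and \<open>5 \<le> M\<close> brings the degree \<open>M + 4\<close> into
  that range. The left-hand sides are the coefficients of \<open>w \<circ> f - w\<close> in degrees \<open>M + 3\<close> and
  \<open>M + 4\<close>, the right-hand sides those of \<open>(f' - 1) w\<close>, where
  \<open>f' - 1 = 3 a\<^sub>2 X\<^sup>2 + 4 a\<^sub>3 X\<^sup>3 + 5 a\<^sub>4 X\<^sup>4 + \<dots>\<close>.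
\<close>
lemma commuting_perturbation_nth:
  fixes u w :: "'k::field fps"
  assumes u: "u $ 0 = 1" "u $ 1 = 0" and w: "\<And>j. j < M \<Longrightarrow> w $ j = 0" and M: "M \<ge> 5"
  defines "f \<equiv> fps_X * u"
  assumes comm: "f oo (fps_X + w) = (fps_X + w) oo f"
  shows "of_nat M * u $ 3 * w $ M + of_nat (M + 1) * u $ 2 * w $ (M + 1)
           = 4 * u $ 3 * w $ M + 3 * u $ 2 * w $ (M + 1)"
    and "(of_nat M * u $ 4 + of_nat (M choose 2) * (u $ 2) ^ 2) * w $ M
           + of_nat (M + 1) * u $ 3 * w $ (M + 1) + of_nat (M + 2) * u $ 2 * w $ (M + 2)
           = 5 * u $ 4 * w $ M + 4 * u $ 3 * w $ (M + 1) + 3 * u $ 2 * w $ (M + 2)"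
proof -
  have X: "fps_X oo f = f"
    by (rule fps_ext) (simp add: fps_X_fps_compose f_def)
  have cd: "comp_diff f w $ n = (fps_deriv f * w) $ n - w $ n" if n: "n < 2 * M" for n
  proof -
    have "comp_diff f w = (f oo (fps_X + w)) - f - w"
      unfolding comm by (simp add: fps_compose_add_distrib X comp_diff_def)
    then show ?thesis
      by (simp add: fps_compose_taylor1_nth[OF w n])
  qed
  have d: "fps_deriv f $ i = of_nat (i + 1) * u $ i" for i
    by (cases i) (simp_all add: f_def algebra_simps)
  have prod: "(fps_deriv f * w) $ (M + k) = (\<Sum>i\<in>{0..k}. of_nat (i + 1) * u $ i * w $ (M + k - i))" for k
    unfolding fps_mult_nth d by (rule sum.mono_neutral_right) (auto simp: w)
  have idx: "{0..3::nat} = {0, 1, 2, 3}" "{0..4::nat} = {0, 1, 2, 3, 4}"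
    by auto
  note nth = comp_diff_nth[OF u w, folded f_def]
  have "comp_diff f w $ (M + 3) = 4 * u $ 3 * w $ M + 3 * u $ 2 * w $ (M + 1)"
    using M u by (subst cd) (simp_all add: prod idx)
  then show "of_nat M * u $ 3 * w $ M + of_nat (M + 1) * u $ 2 * w $ (M + 1)
           = 4 * u $ 3 * w $ M + 3 * u $ 2 * w $ (M + 1)"
    using nth(3) by simp
  have "comp_diff f w $ (M + 4) = 5 * u $ 4 * w $ M + 4 * u $ 3 * w $ (M + 1) + 3 * u $ 2 * w $ (M + 2)"
    using M u by (subst cd) (simp_all add: prod idx)
  then show "(of_nat M * u $ 4 + of_nat (M choose 2) * (u $ 2) ^ 2) * w $ M
           + of_nat (M + 1) * u $ 3 * w $ (M + 1) + of_nat (M + 2) * u $ 2 * w $ (M + 2)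
           = 5 * u $ 4 * w $ M + 4 * u $ 3 * w $ (M + 1) + 3 * u $ 2 * w $ (M + 2)"
    using nth(4) by simp
qed

section \<open>Products of odd and of even numbers in characteristic \<open>p\<close>\<close>

definition odd_prod :: "nat \<Rightarrow> 'k::field" where
  "odd_prod m = (\<Prod>i<m. of_nat (2 * i + 1))"

definition even_prod :: "nat \<Rightarrow> 'k::field" where
  "even_prod m = (\<Prod>i<m. of_nat (2 * i + 2))"

lemma odd_prod_rec: "odd_prod 0 = 1" "odd_prod (Suc m) = of_nat (2 * m + 1) * odd_prod m"
  by (simp_all add: odd_prod_def mult.commute)

lemma even_prod_rec: "even_prod 0 = 1" "even_prod (Suc m) = of_nat (2 * m + 2) * even_prod m"
  by (simp_all add: even_prod_def mult.commute)

lemma odd_prod_mult_even_prod: "odd_prod h * even_prod h = (of_nat (fact (2 * h)) :: 'k::field)"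
proof (induction h)
  case (Suc h)
  have "fact (2 * Suc h) = (2 * h + 1) * (2 * h + 2) * (fact (2 * h) :: nat)"
    by (simp add: algebra_simps)
  then have "(of_nat (fact (2 * Suc h)) :: 'k)
      = of_nat (2 * h + 1) * of_nat (2 * h + 2) * (odd_prod h * even_prod h)"
    by (simp only: of_nat_mult Suc.IH)
  then show ?case
    by (simp only: odd_prod_rec even_prod_rec mult_ac)
qed (simp add: odd_prod_rec even_prod_rec)

lemma odd_prime_char:
  assumes "prime p" "odd p" "CHAR('k::field) = p"
  shows "p \<ge> 3" "(of_nat p :: 'k) = 0" "(2 :: 'k) \<noteq> 0"
proof -
  show p3: "p \<ge> 3" using assms(1,2) prime_ge_2_nat[of p] by (cases "p = 2") auto
  show "(of_nat p :: 'k) = 0" using assms(3) by (simp add: of_nat_eq_0_iff_char_dvd)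
  show "(2 :: 'k) \<noteq> 0"
  proof
    assume "(2 :: 'k) = 0"
    then have "p dvd 2" using assms(3) of_nat_eq_0_iff_char_dvd[where 'a = 'k, of 2] by simp
    with p3 show False by (auto dest: dvd_imp_le)
  qed
qed

lemma wilson_char:
  assumes "prime p" "CHAR('k::field) = p"
  shows "(of_nat (fact (p - 1)) :: 'k) = -1"
proof -
  have "[int (fact (p - 1)) = -1] (mod int p)"
    using wilson_theorem[OF assms(1)] by simp
  then have "int p dvd int (fact (p - 1)) + 1"
    by (simp add: cong_iff_dvd_diff)
  then have "p dvd fact (p - 1) + 1"
    by (metis of_nat_1 of_nat_add of_nat_dvd_iff)
  then have "(of_nat (fact (p - 1) + 1) :: 'k) = 0"
    using assms(2) by (simp only: of_nat_eq_0_iff_char_dvd)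
  then show ?thesis
    by (simp add: eq_neg_iff_add_eq_0 add.commute del: of_nat_fact)
qed

text \<open>
  The part of the third coefficient of \<open>T\<^sup>m X\<close> that has no closed form: a linear recurrence
  with inhomogeneity \<open>r m\<close> scaled by the odd product. Over the rationals it is the odd product of
  length \<open>m + 1\<close> times \<open>\<Sum>j<m. r j / (2j + 3)\<close>.
\<close>
primrec odd_rec :: "(nat \<Rightarrow> 'k::field) \<Rightarrow> nat \<Rightarrow> 'k" where
  "odd_rec r 0 = 0"
| "odd_rec r (Suc m) = of_nat (2 * m + 3) * odd_rec r m + r m * odd_prod (Suc m)"

lemma odd_prod_eq_0:
  assumes "(of_nat (2 * h + 1) :: 'k::field) = 0" "h < m"
  shows "(odd_prod m :: 'k) = 0"
  unfolding odd_prod_def using assms by (intro prod_zero) auto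

text \<open>
  Let \<open>p = 2h + 1\<close> be zero in the field. At the step from \<open>h - 1\<close> to \<open>h\<close> the multiplier is
  \<open>2(h - 1) + 3 = p = 0\<close>, so the history is forgotten and only the inhomogeneity of that step is
  left. From then on the odd products contain the factor \<open>p\<close> and no inhomogeneity is added, while
  the multipliers \<open>2(h + l) + 3 = p + 2l + 2\<close> reduce to the even numbers.
\<close>
lemma odd_rec_past_zero:
  assumes "(of_nat (2 * h + 1) :: 'k::field) = 0" "h = Suc g"
  shows "odd_rec r (h + l) = (r g * odd_prod h * even_prod l :: 'k)"
proof (induction l)
  case 0
  have "2 * g + 3 = 2 * h + 1" using assms(2) by simp
  then show ?case
    using assms by (simp only: add_0_right odd_rec.simps even_prod_rec) simp
next
  case (Suc l)
  have "2 * (h + l) + 3 = (2 * h + 1) + (2 * l + 2)" by simp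
  then have "(of_nat (2 * (h + l) + 3) :: 'k) = of_nat (2 * l + 2)"
    using assms(1) by (simp only: of_nat_add add_0_left)
  moreover have "(odd_prod (Suc (h + l)) :: 'k) = 0"
    by (rule odd_prod_eq_0[OF assms(1)]) simp
  ultimately show ?case
    by (simp only: add_Suc_right odd_rec.simps Suc.IH even_prod_rec mult_zero_right mult_zero_left add_0_right mult_ac)
qed

section \<open>The leading coefficient\<close>

text \<open>
  Induction on \<open>m\<close> with the recurrences of \<open>comp_diff_nth\<close> at \<open>M = 2m + 1\<close>. The second and
  third coefficient are multiplied by powers of \<open>u $ 2\<close> so that no negative power of it occurs
  on the right. The explicit products in the third absorb the even product fed in by the
  second coefficient and adjust the initial value; the remainder is the sequence \<open>odd_rec r\<close>, whose inhomogeneity \<open>r\<close>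
  collects one contribution from two steps with \<open>u $ 3\<close>, one from a step with \<open>u $ 4\<close>, and one from
  the square of \<open>u $ 2\<close> in a power of \<open>u\<close>.
\<close>
lemma comp_diff_iterate_X_nth:
  fixes u :: "'k::field fps"
  assumes u: "u $ 0 = 1" "u $ 1 = 0"
  defines "T \<equiv> \<lambda>m. (comp_diff (fps_X * u) ^^ m) fps_X"
    and "r \<equiv> \<lambda>m. of_nat (2 * m + 2) * (u $ 3) ^ 2 + u $ 2 * u $ 4 + of_nat m * (u $ 2) ^ 3"
  shows "\<forall>j < 2 * m + 1. T m $ j = 0"
    and "T m $ (2 * m + 1) = (u $ 2) ^ m * odd_prod m"
    and "u $ 2 * T m $ (2 * m + 2) = (u $ 2) ^ m * u $ 3 * (odd_prod (Suc m) - even_prod m)"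
    and "(u $ 2) ^ 2 * T m $ (2 * m + 3)
      = (u $ 2) ^ m * (odd_rec r m - (u $ 3) ^ 2 * (even_prod (Suc m) - 2 * odd_prod (Suc m)))"
proof (induction m)
  case 0
  { case 1 show ?case by (simp add: T_def)
    next case 2 show ?case by (simp add: T_def odd_prod_rec)
    next case 3 show ?case by (simp add: T_def odd_prod_rec even_prod_rec)
    next case 4 show ?case by (simp add: T_def odd_prod_rec even_prod_rec) }
next
  case (Suc m)
  have TS: "T (Suc m) = comp_diff (fps_X * u) (T m)"
    by (simp add: T_def)
  define M where "M = 2 * m + 1"
  have idx: "2 * Suc m + 1 = M + 2" "2 * Suc m + 2 = M + 3" "2 * Suc m + 3 = M + 4"
    "2 * m + 1 = M" "2 * m + 2 = M + 1" "2 * m + 3 = M + 2"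
    by (simp_all add: M_def)
  have ch: "of_nat (M choose 2) = (of_nat M * of_nat m :: 'k)"
    unfolding of_nat_mult[symmetric] by (simp add: choose_two M_def mult.assoc del: of_nat_mult)
  have van: "T m $ j = 0" if "j < M" for j
    using Suc(1) that by (simp add: M_def)
  note nth = comp_diff_nth[OF u van, folded TS]
  define A B C where "A = T m $ (2 * m + 1)" and "B = T m $ (2 * m + 2)" and "C = T m $ (2 * m + 3)"
  note IH = Suc(2-4)[folded A_def B_def C_def]
  have A': "T (Suc m) $ (2 * Suc m + 1) = of_nat (2 * m + 1) * u $ 2 * A"
    unfolding A_def idx by (rule nth(2))
  have B': "T (Suc m) $ (2 * Suc m + 2) = of_nat (2 * m + 1) * u $ 3 * A + of_nat (2 * m + 2) * u $ 2 * B"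
    unfolding A_def B_def idx by (rule nth(3))
  have C': "T (Suc m) $ (2 * Suc m + 3)
      = (of_nat (2 * m + 1) * u $ 4 + of_nat (2 * m + 1) * of_nat m * (u $ 2) ^ 2) * A
        + of_nat (2 * m + 2) * u $ 3 * B + of_nat (2 * m + 3) * u $ 2 * C"
    unfolding A_def B_def C_def idx ch[symmetric] by (rule nth(4))
  { case 1 show ?case unfolding idx using nth(1) by blast
    next case 2 show ?case unfolding A' IH(1) odd_prod_rec by simp
    next case 3
      have "u $ 2 * T (Suc m) $ (2 * Suc m + 2)
          = of_nat (2 * m + 1) * u $ 3 * u $ 2 * A + of_nat (2 * m + 2) * u $ 2 * (u $ 2 * B)"
        unfolding B' by (simp only: distrib_left mult_ac)
      then show ?case
        unfolding IH(1,2) odd_prod_rec even_prod_rec by (simp add: algebra_simps)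
    next case 4
      have "(u $ 2) ^ 2 * T (Suc m) $ (2 * Suc m + 3)
         = of_nat (2 * m + 1) * u $ 2 * (u $ 2 * u $ 4 + of_nat m * (u $ 2) ^ 3) * A
          + of_nat (2 * m + 2) * u $ 3 * u $ 2 * (u $ 2 * B) + of_nat (2 * m + 3) * u $ 2 * ((u $ 2) ^ 2 * C)"
        unfolding C' by (simp only: power2_eq_square power3_eq_cube distrib_left distrib_right mult_ac)
      then show ?case
        unfolding IH odd_prod_rec even_prod_rec odd_rec.simps r_def
        by (simp add: algebra_simps power2_eq_square power3_eq_cube) }
qed

text \<open>
  With \<open>p = 2h + 1\<close> and \<open>g = h - 1\<close> only the inhomogeneity at \<open>g\<close> survives, where
  \<open>2g + 2 = p - 1 = -1\<close> and \<open>g = (p - 3) / 2 = -3/2\<close>. Its coefficient is \<open>(p - 1)!\<close>, the product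
  of all odd and all even numbers below \<open>p\<close>, hence \<open>-1\<close> by Wilson's theorem. A factor
  \<open>u $ 2\<close> squared is then cancelled.
\<close>
lemma iterate_coeffs_quadratic_nonzero:
  fixes u :: "'k::field fps"
  assumes p: "prime p" "odd p" "CHAR('k) = p" and u: "u $ 0 = 1" "u $ 1 = 0"
    and nz: "u $ 2 \<noteq> 0"
  defines "w \<equiv> (comp_diff (fps_X * u) ^^ p) fps_X"
  shows "\<forall>j < 2 * p + 3. w $ j = 0"
    and "w $ (2 * p + 3)
      = (u $ 2) ^ (p - 2) * (3 / 2 * (u $ 2) ^ 3 + (u $ 3) ^ 2 - u $ 2 * u $ 4)"
proof -
  note p3 = odd_prime_char(1)[OF p] and p0 = odd_prime_char(2)[OF p] and two = odd_prime_char(3)[OF p]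
  obtain h where h: "p = 2 * h + 1" using p(2) by (elim oddE)
  obtain g where g: "h = Suc g" using p3 h by (cases h) auto
  note T = comp_diff_iterate_X_nth[OF u, of p, folded w_def]
  have P: "(odd_prod m :: 'k) = 0" if "m \<ge> p" for m
    by (rule odd_prod_eq_0[of h]) (use p0 h that in simp_all)
  have Q: "(even_prod m :: 'k) = 0" if "m \<ge> p" for m
    unfolding even_prod_def
  proof (rule prod_zero)
    have "2 * (p - 1) + 2 = 2 * p" using p3 by simp
    then have "(of_nat (2 * (p - 1) + 2) :: 'k) = 0"
      by (simp only: of_nat_mult p0 mult_zero_right)
    then show "\<exists>i\<in>{..<m}. (of_nat (2 * i + 2) :: 'k) = 0"
      using that p3 by (intro bexI[of _ "p - 1"]) auto
  qed simp
  have W: "(odd_prod h * even_prod (Suc h) :: 'k) = -1"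
  proof -
    have "2 * h + 2 = p + 1" using h by simp
    then have "(of_nat (2 * h + 2) :: 'k) = 1" using p0 by (simp only: of_nat_add) simp
    then have "(odd_prod h * even_prod (Suc h) :: 'k) = of_nat (fact (2 * h))"
      by (simp only: even_prod_rec mult_1_left odd_prod_mult_even_prod)
    then show ?thesis using wilson_char[OF p(1,3)] h by simp
  qed
  have h0: "(of_nat (2 * h + 1) :: 'k) = 0" using p0 h by simp
  have x: "odd_rec r p = - r g" for r :: "nat \<Rightarrow> 'k"
  proof -
    have "odd_rec r (h + Suc h) = r g * (odd_prod h * even_prod (Suc h))"
      using odd_rec_past_zero[OF h0 g] by (simp only: mult.assoc)
    moreover have "h + Suc h = p" using h by simp
    ultimately show ?thesis unfolding W by (simp only: mult_minus_right mult_1_right)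
  qed
  have "w $ (2 * p + 1) = 0" "w $ (2 * p + 2) = 0"
    using T(2,3) nz by (simp_all add: P Q)
  moreover have "j < 2 * p + 1 \<or> j = 2 * p + 1 \<or> j = 2 * p + 2" if "j < 2 * p + 3" for j
    using that by linarith
  ultimately show "\<forall>j < 2 * p + 3. w $ j = 0"
    using T(1) by blast
  have g': "(of_nat g :: 'k) = - 3 / 2"
  proof -
    have "2 * g + 3 = p" using g h by simp
    then have "(2 * of_nat g + 3 :: 'k) = 0" using p0
      by (metis of_nat_add of_nat_mult of_nat_numeral)
    then show ?thesis using two by (simp add: field_simps eq_neg_iff_add_eq_0)
  qed
  have "(u $ 2) ^ 2 * w $ (2 * p + 3) = (u $ 2) ^ p *
      (- (of_nat (2 * g + 2) * (u $ 3) ^ 2 + u $ 2 * u $ 4 + of_nat g * (u $ 2) ^ 3))"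
    unfolding T(4) by (simp add: x P Q)
  also have "(of_nat (2 * g + 2) :: 'k) = -1"
    using g' two by simp
  also have "(u $ 2) ^ p = (u $ 2) ^ 2 * (u $ 2) ^ (p - 2)"
  proof -
    have "p = 2 + (p - 2)" using p3 by simp
    then show ?thesis by (metis power_add)
  qed
  finally show "w $ (2 * p + 3)
      = (u $ 2) ^ (p - 2) * (3 / 2 * (u $ 2) ^ 3 + (u $ 3) ^ 2 - u $ 2 * u $ 4)"
    using nz by (simp add: g')
qed

section \<open>The next two coefficients\<close>

text \<open>
  The comparison of coefficients for commuting series is applied at \<open>M = 2p + 3\<close>. Since \<open>M\<close>
  and \<open>M choose 2\<close> are both \<open>3\<close> in the field, the two relations become
  \<open>a\<^sub>2 \<beta> = a\<^sub>3 \<alpha>\<close> and, after use of the first,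
  \<open>2 a\<^sub>2 \<gamma> = (2 a\<^sub>4 - 3 a\<^sub>2\<^sup>2) \<alpha>\<close>.
\<close>
lemma iterate_coeffs_quadratic_nonzero_next:
  fixes u :: "'k::field fps"
  assumes p: "prime p" "odd p" "CHAR('k) = p" and u: "u $ 0 = 1" "u $ 1 = 0"
    and nz: "u $ 2 \<noteq> 0"
  defines "w \<equiv> (comp_diff (fps_X * u) ^^ p) fps_X"
  shows "w $ (2 * p + 4) = u $ 3 / u $ 2 * w $ (2 * p + 3)"
    and "w $ (2 * p + 5) = - (3 * u $ 2 / 2 - u $ 4 / u $ 2) * w $ (2 * p + 3)"
proof -
  define f where "f = fps_X * u"
  define M where "M = 2 * p + 3"
  have f0: "f $ 0 = 0" by (simp add: f_def)
  note p3 = odd_prime_char(1)[OF p] and p0 = odd_prime_char(2)[OF p] and two = odd_prime_char(3)[OF p]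
  have it: "fps_iter p f = fps_X + w"
    unfolding w_def f_def[symmetric] by (rule fps_iter_char_eq_comp_diff[OF p(1,3) f0])
  have comm: "f oo (fps_X + w) = (fps_X + w) oo f"
    using fps_iter_eq_precompose(2)[OF f0, of p] unfolding it by simp
  have van: "w $ j = 0" if "j < M" for j
    using iterate_coeffs_quadratic_nonzero(1)[OF p u nz] that unfolding w_def M_def by blast
  have M5: "M \<ge> 5" using p3 by (simp add: M_def)
  have M3: "(of_nat M :: 'k) = 3" by (simp add: M_def p0)
  have "M choose 2 = (2 * p + 3) * (p + 1)"
    by (simp add: choose_two M_def algebra_simps)
  then have ch: "(of_nat (M choose 2) :: 'k) = 3" by (simp add: p0)
  note E = commuting_perturbation_nth[OF u van M5 comm[unfolded f_def], unfolded ch of_nat_add M3]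
  have e1: "u $ 2 * w $ (M + 1) = u $ 3 * w $ M"
    using E(1) by (simp add: algebra_simps) algebra
  have e2: "2 * u $ 2 * w $ (M + 2) = (2 * u $ 4 - 3 * (u $ 2) ^ 2) * w $ M"
    using E(2) by (simp add: algebra_simps) algebra
  have idx: "2 * p + 4 = M + 1" "2 * p + 5 = M + 2" "2 * p + 3 = M"
    by (simp_all add: M_def)
  show "w $ (2 * p + 4) = u $ 3 / u $ 2 * w $ (2 * p + 3)"
    unfolding idx using e1 nz by (simp add: field_simps)
  show "w $ (2 * p + 5) = - (3 * u $ 2 / 2 - u $ 4 / u $ 2) * w $ (2 * p + 3)"
    unfolding idx using e2 nz two by (simp add: field_simps power2_eq_square)
qed

section \<open>Vanishing quadratic coefficient\<close>

lemma comp_diff_nth_quadratic_zero: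
  fixes u g :: "'k::field fps"
  assumes u: "u $ 0 = 1" "u $ 1 = 0" "u $ 2 = 0" and g: "\<And>j. j < M \<Longrightarrow> g $ j = 0"
  shows "\<And>j. j < M + 3 \<Longrightarrow> comp_diff (fps_X * u) g $ j = 0"
    and "comp_diff (fps_X * u) g $ (M + 3) = of_nat M * u $ 3 * g $ M"
    and "comp_diff (fps_X * u) g $ (M + 4)
      = of_nat M * u $ 4 * g $ M + of_nat (M + 1) * u $ 3 * g $ (M + 1)"
proof -
  note nth = comp_diff_nth[OF u(1,2) g]
  show "comp_diff (fps_X * u) g $ j = 0" if "j < M + 3" for j
  proof (cases "j = M + 2")
    case True
    then show ?thesis using nth(2) u by simp
  next
    case False
    then show ?thesis using nth(1)[of M j] that by simp
  qed
  show "comp_diff (fps_X * u) g $ (M + 3) = of_nat M * u $ 3 * g $ M"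
    using nth(3) u by simp
  show "comp_diff (fps_X * u) g $ (M + 4)
      = of_nat M * u $ 4 * g $ M + of_nat (M + 1) * u $ 3 * g $ (M + 1)"
    using nth(4) u by simp
qed

lemma comp_diff_iterate_quadratic_zero_nth:
  fixes u :: "'k::field fps"
  assumes u: "u $ 0 = 1" "u $ 1 = 0" "u $ 2 = 0"
  shows "\<forall>j < 3 * m + 1. (comp_diff (fps_X * u) ^^ m) fps_X $ j = 0"
proof (induction m)
  case (Suc m)
  have "comp_diff (fps_X * u) ((comp_diff (fps_X * u) ^^ m) fps_X) $ j = 0"
    if "j < 3 * m + 1 + 3" for j
    by (rule comp_diff_nth_quadratic_zero(1)[OF u _ that]) (use Suc in auto)
  then show ?case by simp
qed simp

text \<open>
  Starting from \<open>X\<close>, the pairs of lowest coefficients are multiplied through the degrees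
  \<open>(4, 5)\<close>, \<open>(7, 8)\<close>, \<open>(10, 11)\<close>. Over the integers the result is \<open>28 a\<^sub>3\<^sup>3\<close> and
  \<open>100 a\<^sub>3\<^sup>2 a\<^sub>4\<close>, and both constants are \<open>1\<close> modulo \<open>3\<close>.
\<close>
lemma comp_diff_cube_quadratic_zero_nth:
  fixes u :: "'k::field fps"
  assumes u: "u $ 0 = 1" "u $ 1 = 0" "u $ 2 = 0" and three: "(3 :: 'k) = 0"
  shows "(comp_diff (fps_X * u) ^^ 3) fps_X $ 10 = (u $ 3) ^ 3"
    and "(comp_diff (fps_X * u) ^^ 3) fps_X $ 11 = (u $ 3) ^ 2 * u $ 4"
proof -
  define T where "T m = (comp_diff (fps_X * u) ^^ m) fps_X" for m
  have TS: "T (Suc m) = comp_diff (fps_X * u) (T m)" for m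
    by (simp add: T_def)
  have van: "T m $ j = 0" if "j < 3 * m + 1" for m j
    using comp_diff_iterate_quadratic_zero_nth[OF u] that by (simp add: T_def)
  note nth = comp_diff_nth_quadratic_zero[OF u van, folded TS]
  have "T 1 $ 4 = u $ 3" "T 1 $ 5 = u $ 4"
    using nth(2,3)[of 1 0] by (simp_all add: T_def)
  then have "T 2 $ 7 = 4 * (u $ 3) ^ 2" "T 2 $ 8 = 9 * u $ 3 * u $ 4"
    using nth(2,3)[of 4 1] by (simp_all add: numeral_2_eq_2 algebra_simps)
  then have *: "T 3 $ 10 = 28 * (u $ 3) ^ 3" "T 3 $ 11 = 100 * (u $ 3) ^ 2 * u $ 4"
    using nth(2,3)[of 7 2] by (simp_all add: numeral_3_eq_3 numeral_2_eq_2 algebra_simps power2_eq_square power3_eq_cube)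
  have "(28 :: 'k) = 9 * 3 + 1" "(100 :: 'k) = 33 * 3 + 1" by simp_all
  then have "(28 :: 'k) = 1" "(100 :: 'k) = 1" unfolding three by simp_all
  with * show "(comp_diff (fps_X * u) ^^ 3) fps_X $ 10 = (u $ 3) ^ 3"
    "(comp_diff (fps_X * u) ^^ 3) fps_X $ 11 = (u $ 3) ^ 2 * u $ 4"
    by (simp_all add: T_def)
qed

section \<open>The expansion of the iterate\<close>

lemma fps_X_power_dvdI:
  fixes g :: "'k::field fps"
  assumes "\<And>j. j < N \<Longrightarrow> g $ j = 0"
  shows "fps_X ^ N dvd g"
proof
  show "g = fps_X ^ N * fps_shift N g"
    by (rule fps_ext) (simp add: fps_X_power_mult_nth assms)
qed

theorem mainTheorem4:
  fixes p :: nat and a :: "nat \<Rightarrow> 'k::field" and f :: "'k fps"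
  assumes "prime p" and "odd p" and "CHAR('k) = p"
    and "f = fps_X * (1 + Abs_fps (\<lambda>j. if j \<ge> 2 then a j else 0))"
  shows "fps_X ^ (2 * p + 6) dvd
           fps_iter p f -
           (fps_X + fps_const (alpha1 p a) * fps_X ^ (2 * p + 3)
                  + fps_const (beta1 p a) * fps_X ^ (2 * p + 4)
                  + fps_const (gamma1 p a) * fps_X ^ (2 * p + 5))"
proof -
  define u where "u = 1 + Abs_fps (\<lambda>j. if j \<ge> 2 then a j else 0)"
  have u: "u $ 0 = 1" "u $ 1 = 0" "u $ 2 = a 2" "u $ 3 = a 3" "u $ 4 = a 4"
    by (simp_all add: u_def)
  have f: "f = fps_X * u" using assms(4) by (simp add: u_def)
  define w where "w = (comp_diff (fps_X * u) ^^ p) fps_X"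
  have it: "fps_iter p f = fps_X + w"
    unfolding w_def f by (rule fps_iter_char_eq_comp_diff[OF assms(1,3)]) simp
  note p3 = odd_prime_char(1)[OF assms(1-3)]
  have coeffs: "(\<forall>j < 2 * p + 3. w $ j = 0) \<and> w $ (2 * p + 3) = alpha1 p a
      \<and> w $ (2 * p + 4) = beta1 p a \<and> w $ (2 * p + 5) = gamma1 p a"
  proof (cases "a 2 = 0")
    case False
    then have nz: "u $ 2 \<noteq> 0" by (simp add: u)
    note 1 = iterate_coeffs_quadratic_nonzero[OF assms(1-3) u(1,2) nz, folded w_def]
    note 2 = iterate_coeffs_quadratic_nonzero_next[OF assms(1-3) u(1,2) nz, folded w_def]
    show ?thesis
      unfolding beta1_eq[of p a, OF p3 False] gamma1_eq[of p a, OF p3 False] using 1 2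
      by (simp add: u alpha1_def)
  next
    case True
    then have u2: "u $ 2 = 0" by (simp add: u)
    have van: "w $ j = 0" if "j < 3 * p + 1" for j
      using comp_diff_iterate_quadratic_zero_nth[OF u(1,2) u2] that by (simp add: w_def)
    \<comment> \<open>For \<open>p = 3\<close> the factor \<open>a 2 ^ (p - 3)\<close> of \<open>beta1\<close> and \<open>gamma1\<close> is \<open>0 ^ 0 = 1\<close>.\<close>
    show ?thesis
    proof (cases "p = 3")
      case p: True
      have three: "(3 :: 'k) = 0"
        using assms(3) p of_nat_eq_0_iff_char_dvd[where 'a = 'k, of 3] by simp
      show ?thesis
        using comp_diff_cube_quadratic_zero_nth[OF u(1,2) u2 three] van True
        by (simp add: p w_def u alpha1_def beta1_def gamma1_def power2_eq_square power3_eq_cube)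
    next
      case False
      moreover have "p \<noteq> 4" using assms(2) by auto
      ultimately have "p \<ge> 5" using p3 by simp
      then show ?thesis
        using van True by (simp add: alpha1_def beta1_def gamma1_def)
    qed
  qed
  show ?thesis
  proof (rule fps_X_power_dvdI)
    fix j assume "j < 2 * p + 6"
    then consider "j < 2 * p + 3" | "j = 2 * p + 3" | "j = 2 * p + 4" | "j = 2 * p + 5"
      by linarith
    then show "(fps_iter p f -
           (fps_X + fps_const (alpha1 p a) * fps_X ^ (2 * p + 3)
                  + fps_const (beta1 p a) * fps_X ^ (2 * p + 4)
                  + fps_const (gamma1 p a) * fps_X ^ (2 * p + 5))) $ j = 0"
      unfolding it by cases (use coeffs in \<open>simp_all del: power_Suc\<close>)
  qed
qed

end
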